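(* (1) In each of the following groups of consecutive patterns of length $4$, any two patterns in the same group are super-strongly Wilf equivalent: (i) $0102, 0112$; (ii) $0021, 0121$; (iii) $1002, 1012, 1102$; (iv) $0100, 0110$; (v) $2013, 2103$; (vi) $1200, 1210, 1220$; (vii) $0211, 0221$; (viii) $1000, 1110$; (ix) $1001, 1011, 1101$; (x) $2100, 2210$; (xi) $2001, 2011, 2101, 2201$; (xii) $2012, 2102$; (xiii) $2010, 2110, 2120$; (xiv) $3012, 3102$. (2) Conversely, if $p\neq p'$ are consecutive patterns of length $4$ that are Wilf equivalent, then $p$ and $p'$ belong to the same group among (i)--(xiv). In particular, the only generalized Wilf equivalences (of any of the three types) between distinct consecutive patterns of length 4 are those listed in (1).
   Context: An inversion sequence of length $n$ is an integer sequence $e=e_1e_2\dots e_n$ with $0\le e_i<i$ for all $i$; $\mathbf{I}_n$ denotes the set of these. A pattern of length $r$ is a sequence $p=p_1\dots p_r$ with $p_i\in\{0,\dots,r-1\}$ such that whenever a value $j>0$ appears in $p$, the value $j-1$ also appears. The reduction of an integer word $w$ is obtained by replacing every occurrence of the $i$-th smallest distinct value of $w$ by $i-1$, for all $i$. An inversion sequence $e$ has an occurrence of the consecutive pattern $p$ (of length $r$) in position $i$ if the reduction of $e_ie_{i+1}\dots e_{i+r-1}$ equals $p$; $\mathrm{Em}(p,e)$ is the set of such positions $i$; $e$ avoids $p$ if $\mathrm{Em}(p,e)=\emptyset$, and $\mathbf{I}_n(p)$ is the set of $e\in\mathbf{I}_n$ avoiding $p$. Two consecutive patterns $p,p'$ are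 Wilf equivalent if $|\mathbf{I}_n(p)|=|\mathbf{I}_n(p')|$ for all $n$; strongly Wilf equivalent if for all $n,m$ the number of $e\in\mathbf{I}_n$ with exactly $m$ occurrences of $p$ equals that for $p'$; super-strongly Wilf equivalent if $|\{e\in\mathbf{I}_n:\mathrm{Em}(p,e)=T\}|=|\{e\in\mathbf{I}_n:\mathrm{Em}(p',e)=T\}|$ for all $n$ and all $T\subseteq[n]$. Super-strong implies strong implies Wilf equivalence. *)

theory Defs
  imports Main
begin

text \<open>Inversion sequences of length n, stored as lists (0-indexed):
  e = e_1 ... e_n with 0 \<le> e_i < i becomes  e ! k \<le> k  for k < n.\<close>
definition inv_seqs :: "nat \<Rightarrow> nat list set" where
  "inv_seqs n = {e. length e = n \<and> (\<forall>k<n. e ! k < Suc k)}"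

definition is_pattern :: "nat \<Rightarrow> nat list \<Rightarrow> bool" where
  "is_pattern r p \<longleftrightarrow> length p = r \<and> (\<forall>x\<in>set p. x < r)
     \<and> (\<forall>j\<in>set p. j > 0 \<longrightarrow> j - 1 \<in> set p)"

definition reduction :: "nat list \<Rightarrow> nat list" where
  "reduction w = map (\<lambda>x. card {y \<in> set w. y < x}) w"

definition Em :: "nat list \<Rightarrow> nat list \<Rightarrow> nat set" where
  "Em p e = {i. 1 \<le> i \<and> i + length p - 1 \<le> length e
                \<and> reduction (take (length p) (drop (i - 1) e)) = p}"

definition avoiders :: "nat list \<Rightarrow> nat \<Rightarrow> nat list set" where
  "avoiders p n = {e \<in> inv_seqs n. Em p e = {}}"

definition wilf_equiv :: "nat list \<Rightarrow> nat list \<Rightarrow> bool" where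
  "wilf_equiv p q \<longleftrightarrow> (\<forall>n. card (avoiders p n) = card (avoiders q n))"

definition strongly_wilf_equiv :: "nat list \<Rightarrow> nat list \<Rightarrow> bool" where
  "strongly_wilf_equiv p q \<longleftrightarrow> (\<forall>n m.
     card {e \<in> inv_seqs n. card (Em p e) = m} = card {e \<in> inv_seqs n. card (Em q e) = m})"

definition super_strongly_wilf_equiv :: "nat list \<Rightarrow> nat list \<Rightarrow> bool" where
  "super_strongly_wilf_equiv p q \<longleftrightarrow> (\<forall>n T. T \<subseteq> {1..n} \<longrightarrow>
     card {e \<in> inv_seqs n. Em p e = T} = card {e \<in> inv_seqs n. Em q e = T})"

definition groups4 :: "nat list list list" where
  "groups4 = [
    [[0,1,0,2],[0,1,1,2]],
    [[0,0,2,1],[0,1,2,1]],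
    [[1,0,0,2],[1,0,1,2],[1,1,0,2]],
    [[0,1,0,0],[0,1,1,0]],
    [[2,0,1,3],[2,1,0,3]],
    [[1,2,0,0],[1,2,1,0],[1,2,2,0]],
    [[0,2,1,1],[0,2,2,1]],
    [[1,0,0,0],[1,1,1,0]],
    [[1,0,0,1],[1,0,1,1],[1,1,0,1]],
    [[2,1,0,0],[2,2,1,0]],
    [[2,0,0,1],[2,0,1,1],[2,1,0,1],[2,2,0,1]],
    [[2,0,1,2],[2,1,0,2]],
    [[2,0,1,0],[2,1,1,0],[2,1,2,0]],
    [[3,0,1,2],[3,1,0,2]]]"

end

theory Submission
  imports Defs
begin

text \<open>
  Within a group, \<open>p\<close> and \<open>q\<close> have the same letters and the same first and last letter, so an
  occurrence of \<open>p\<close> turns into one of \<open>q\<close> by rewriting its two middle entries only, and the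
  bounds \<open>e\<^sub>i < i\<close> survive. By inclusion-exclusion it is enough to count the sequences with
  occurrences at least at a prescribed set \<open>S\<close> of positions. The occurrences at \<open>S\<close> are rewritten
  one by one from left to right: elements of \<open>S\<close> at distance 1 never coexist, those at distance
  at least 3 do not see the change, and at distance 2 they either never coexist or the rewriting is
  harmless provided that everything to the left already matches \<open>q\<close> and everything to the right
  still matches \<open>p\<close>.

  Different classes are told apart by the number of avoiders of length at most 11, computed by
  dynamic programming over the last three entries.
\<close>

subsection \<open>Occurrences as order isomorphisms\<close>

definition same_order :: "nat \<Rightarrow> nat \<Rightarrow> nat \<Rightarrow> nat \<Rightarrow> bool" where
  "same_order i j x y \<longleftrightarrow> (if i < j then x < y else if j < i then y < x else x = y)"

text \<open>The six comparisons are bracketed so that the three not involving the first entry come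
  first; the table computation later splits the test along this bracket.\<close>

definition matches :: "nat list \<Rightarrow> nat \<Rightarrow> nat \<Rightarrow> nat \<Rightarrow> nat \<Rightarrow> bool" where
  "matches p a b c d \<longleftrightarrow>
     (same_order (p!2) (p!3) c d \<and> same_order (p!1) (p!2) b c \<and> same_order (p!1) (p!3) b d) \<and>
     (same_order (p!0) (p!1) a b \<and> same_order (p!0) (p!2) a c \<and> same_order (p!0) (p!3) a d)"

text \<open>Positions count from 0 here, from 1 in \<open>Em\<close>. An arbitrary predicate
  \<open>P\<close> allows occurrences of two patterns to be mixed in one sequence.\<close>

definition occ :: "(nat \<Rightarrow> nat \<Rightarrow> nat \<Rightarrow> nat \<Rightarrow> bool) \<Rightarrow> nat list \<Rightarrow> nat \<Rightarrow> bool" where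
  "occ P e i \<longleftrightarrow> i + 3 < length e \<and> P (e ! i) (e ! (i+1)) (e ! (i+2)) (e ! (i+3))"

section \<open>Reductions and pairwise comparisons\<close>

lemma is_pattern_downward:
  assumes "is_pattern r p" "j \<in> set p" "i \<le> j"
  shows "i \<in> set p"
  using assms(3,2)
proof (induction rule: inc_induct)
  case (step n)
  then show ?case using assms(1) unfolding is_pattern_def by (metis Suc_diff_1 diff_Suc_1 zero_less_Suc)
qed

text \<open>The letters of a pattern form an initial segment of the naturals, so exactly
  \<open>x\<close> of them lie below the letter \<open>x\<close>.\<close>

lemma reduction_pattern:
  assumes "is_pattern r p" shows "reduction p = p"
proof -
  have "{y \<in> set p. y < x} = {..<x}" if "x \<in> set p" for x
    using is_pattern_downward[OF assms that] by auto
  then show ?thesis by (simp add: reduction_def map_idI)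
qed

text \<open>Both images are in bijection with the classes of \<open>J\<close> under the common
  kernel. This compares numbers of distinct values in two words.\<close>

lemma card_image_cong_kernel:
  assumes "\<And>x y. x \<in> J \<Longrightarrow> y \<in> J \<Longrightarrow> f x = f y \<longleftrightarrow> g x = g y"
  shows "card (f ` J) = card (g ` J)"
proof -
  have "bij_betw (\<lambda>z. g (inv_into J f z)) (f ` J) (g ` J)"
    unfolding bij_betw_def
  proof
    show "inj_on (\<lambda>z. g (inv_into J f z)) (f ` J)"
      by (rule inj_onI) (metis assms f_inv_into_f inv_into_into)
    have "g (inv_into J f (f x)) = g x" if "x \<in> J" for x
      by (metis assms f_inv_into_f imageI inv_into_into that)
    then show "(\<lambda>z. g (inv_into J f z)) ` f ` J = g ` J" by (auto simp: image_image)
  qed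
  then show ?thesis by (rule bij_betw_same_card)
qed

lemma reduction_nth:
  assumes "i < length w"
  shows "reduction w ! i = card ((!) w ` {j. j < length w \<and> w ! j < w ! i})"
proof -
  have "{y \<in> set w. y < w ! i} = (!) w ` {j. j < length w \<and> w ! j < w ! i}"
    by (auto simp: in_set_conv_nth)
  then show ?thesis using assms by (simp add: reduction_def)
qed

lemma reduction_cong:
  assumes "length w = length p"
    and "\<And>i j. i < length p \<Longrightarrow> j < length p \<Longrightarrow> w ! i < w ! j \<longleftrightarrow> p ! i < p ! j"
  shows "reduction w = reduction p"
proof (rule nth_equalityI)
  show "length (reduction w) = length (reduction p)" using assms(1) by (simp add: reduction_def)
next
  fix i assume "i < length (reduction w)"
  then have i: "i < length p" "i < length w" using assms(1) by (simp_all add: reduction_def)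
  let ?J = "{j. j < length p \<and> p ! j < p ! i}"
  have "{j. j < length w \<and> w ! j < w ! i} = ?J" using assms i by auto
  \<comment> \<open>Two entries are equal iff neither is below the other, so \<open>w\<close> and
    \<open>p\<close> have the same kernel on these indices.\<close>
  moreover have "card ((!) w ` ?J) = card ((!) p ` ?J)"
    by (rule card_image_cong_kernel) (metis (lifting) assms(2) mem_Collect_eq linorder_neq_iff)
  ultimately show "reduction w ! i = reduction p ! i" using reduction_nth i by simp
qed

text \<open>For \<open>a < b\<close> with \<open>a\<close> in the word, \<open>a\<close> itself is
  counted below \<open>b\<close> but not below \<open>a\<close>, so ranks increase strictly.\<close>

lemma reduction_less_iff:
  assumes "i < length w" "j < length w"
  shows "reduction w ! i < reduction w ! j \<longleftrightarrow> w ! i < w ! j"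
proof -
  have strict: "card {y \<in> set w. y < a} < card {y \<in> set w. y < b}" if "a < b" "a \<in> set w" for a b
    by (rule psubset_card_mono) (use that in auto)
  show ?thesis
    using strict[of "w!i" "w!j"] strict[of "w!j" "w!i"] assms
    by (cases "w!i" "w!j" rule: linorder_cases) (auto simp: reduction_def)
qed

lemma reduction_eq_iff:
  assumes "is_pattern r p" "length w = length p"
  shows "reduction w = p \<longleftrightarrow> (\<forall>i<length p. \<forall>j<length p. w ! i < w ! j \<longleftrightarrow> p ! i < p ! j)"
  using reduction_less_iff[of _ w] reduction_cong[of w p] reduction_pattern[OF assms(1)] assms(2) by metis

lemma reduction_eq_iff_matches:
  assumes "is_pattern 4 p"
  shows "reduction [a,b,c,d] = p \<longleftrightarrow> matches p a b c d"
proof -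
  have l: "length p = 4" using assms by (simp add: is_pattern_def)
  have all4: "(\<forall>i<4::nat. R i) \<longleftrightarrow> R 0 \<and> R 1 \<and> R 2 \<and> R 3" for R
    by (auto simp: numeral_eq_Suc less_Suc_eq)
  have "reduction [a,b,c,d] = p \<longleftrightarrow> (\<forall>i<4. \<forall>j<4. [a,b,c,d] ! i < [a,b,c,d] ! j \<longleftrightarrow> p ! i < p ! j)"
    using reduction_eq_iff[OF assms, of "[a,b,c,d]"] l by simp
  \<comment> \<open>The sixteen strict comparisons amount to one three-way comparison for each of
    the six pairs of positions.\<close>
  also have "\<dots> \<longleftrightarrow> matches p a b c d"
    unfolding all4 matches_def same_order_def
    by (simp add: numeral_eq_Suc) linarith
  finally show ?thesis .
qed

lemma Em_eq:
  assumes "is_pattern 4 p"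
  shows "Em p e = Suc ` {i. occ (matches p) e i}"
proof -
  have l: "length p = 4" using assms by (simp add: is_pattern_def)
  have win: "take 4 (drop i e) = [e ! i, e ! (i+1), e ! (i+2), e ! (i+3)]" if "i + 3 < length e" for i
    using that by (intro nth_equalityI) (auto simp: less_Suc_eq numeral_eq_Suc)
  have "Suc i \<in> Em p e \<longleftrightarrow> occ (matches p) e i" for i
  proof -
    have "Suc i \<in> Em p e \<longleftrightarrow> i + 3 < length e \<and> reduction (take 4 (drop i e)) = p"
      by (auto simp: Em_def l)
    also have "\<dots> \<longleftrightarrow> i + 3 < length e \<and> matches p (e ! i) (e ! (i+1)) (e ! (i+2)) (e ! (i+3))"
      by (rule conj_cong[OF refl]) (simp only: win reduction_eq_iff_matches[OF assms])
    finally show ?thesis by (simp only: occ_def)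
  qed
  moreover have "0 \<notin> Em p e" by (simp add: Em_def)
  ultimately show ?thesis by (auto simp: image_iff) (metis not0_implies_Suc)
qed

subsection \<open>Exchanging occurrences\<close>

lemma finite_inv_seqs: "finite (inv_seqs n)"
proof -
  have "inv_seqs n \<subseteq> {e. set e \<subseteq> {..<n} \<and> length e = n}"
    by (auto simp: inv_seqs_def in_set_conv_nth) (metis less_Suc_eq_le order_le_less_trans)
  then show ?thesis by (rule finite_subset) (simp add: finite_lists_length_eq)
qed

text \<open>Inclusion-exclusion as an induction from large \<open>T\<close> to small: the superset
  count of \<open>T\<close> is its exact count plus those of the proper supersets, which agree by
  induction.\<close>

lemma card_fibres_eq_if_supersets_eq:
  assumes fin: "finite A" "finite U"
    and sub: "\<And>e. e \<in> A \<Longrightarrow> F e \<subseteq> U" "\<And>e. e \<in> A \<Longrightarrow> G e \<subseteq> U"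
    and eq: "\<And>S. S \<subseteq> U \<Longrightarrow> card {e \<in> A. S \<subseteq> F e} = card {e \<in> A. S \<subseteq> G e}"
    and "T \<subseteq> U"
  shows "card {e \<in> A. F e = T} = card {e \<in> A. G e = T}"
  using \<open>T \<subseteq> U\<close>
proof (induction "card (U - T)" arbitrary: T rule: less_induct)
  case less
  have split: "card {e \<in> A. T \<subseteq> H e} = card {e \<in> A. H e = T} + (\<Sum>V | T \<subset> V \<and> V \<subseteq> U. card {e \<in> A. H e = V})"
    if "\<And>e. e \<in> A \<Longrightarrow> H e \<subseteq> U" for H
  proof -
    let ?\<V> = "{V. T \<subset> V \<and> V \<subseteq> U}"
    have finV: "finite ?\<V>" by (rule finite_subset[of _ "Pow U"]) (use fin in auto)
    have "{e \<in> A. T \<subseteq> H e} = {e \<in> A. H e = T} \<union> (\<Union>V\<in>?\<V>. {e \<in> A. H e = V})"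
      using that by auto
    also have "card \<dots> = card {e \<in> A. H e = T} + card (\<Union>V\<in>?\<V>. {e \<in> A. H e = V})"
      by (rule card_Un_disjoint) (use fin finV in auto)
    also have "card (\<Union>V\<in>?\<V>. {e \<in> A. H e = V}) = (\<Sum>V\<in>?\<V>. card {e \<in> A. H e = V})"
      by (rule card_UN_disjoint) (use fin finV in auto)
    finally show ?thesis .
  qed
  have "(\<Sum>V | T \<subset> V \<and> V \<subseteq> U. card {e \<in> A. F e = V}) = (\<Sum>V | T \<subset> V \<and> V \<subseteq> U. card {e \<in> A. G e = V})"
  proof (rule sum.cong)
    fix V assume "V \<in> {V. T \<subset> V \<and> V \<subseteq> U}"
    then have "U - V \<subset> U - T" "V \<subseteq> U" by auto
    then show "card {e \<in> A. F e = V} = card {e \<in> A. G e = V}"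
      using less.hyps[of V] psubset_card_mono[of "U - T"] fin by auto
  qed simp
  then show ?case using split[of F] split[of G] eq[OF less.prems] sub by simp
qed

section \<open>Rewriting the middle of one occurrence\<close>

definition respell ::
  "(nat \<Rightarrow> nat \<Rightarrow> nat \<Rightarrow> nat \<Rightarrow> nat) \<Rightarrow> (nat \<Rightarrow> nat \<Rightarrow> nat \<Rightarrow> nat \<Rightarrow> nat) \<Rightarrow> nat \<Rightarrow> nat list \<Rightarrow> nat list" where
  "respell f g j e = e[j+1 := f (e!j) (e!(j+1)) (e!(j+2)) (e!(j+3)),
                       j+2 := g (e!j) (e!(j+1)) (e!(j+2)) (e!(j+3))]"

text \<open>Only positions \<open>j+1\<close> and \<open>j+2\<close> change. A window starting at
  \<open>j-2\<close> sees just the first of them, as its last entry; one starting at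
  \<open>j+2\<close> sees just the second, as its first entry; windows at distance at least 3 see
  neither. Distance 1 is excluded by \<open>gap\<close>. Separate predicates \<open>L\<close> and
  \<open>R\<close> let the lemma serve both directions of the exchange.\<close>

lemma respell_occ:
  assumes e: "e \<in> inv_seqs n" and j: "j \<in> S" "occ P e j"
    and left_occ: "\<And>i. i \<in> S \<Longrightarrow> i < j \<Longrightarrow> occ L e i"
    and right_occ: "\<And>i. i \<in> S \<Longrightarrow> j < i \<Longrightarrow> occ R e i"
    and gap: "\<And>i. i \<in> S \<Longrightarrow> Suc i \<notin> S"
    and PQ: "\<And>a b c d. P a b c d \<Longrightarrow> Q a (f a b c d) (g a b c d) d"
    and bound: "\<And>a b c d k. P a b c d \<Longrightarrow> a \<le> k \<Longrightarrow> b \<le> k+1 \<Longrightarrow> c \<le> k+2 \<Longrightarrow> d \<le> k+3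
        \<Longrightarrow> f a b c d \<le> k+1 \<and> g a b c d \<le> k+2"
    and left: "\<And>i u v a b c d. i \<in> S \<Longrightarrow> i+2 \<in> S \<Longrightarrow> L u v a b \<Longrightarrow> P a b c d \<Longrightarrow> L u v a (f a b c d)"
    and right: "\<And>i a b c d s t. i \<in> S \<Longrightarrow> i+2 \<in> S \<Longrightarrow> P a b c d \<Longrightarrow> R c d s t \<Longrightarrow> R (g a b c d) d s t"
  shows "respell f g j e \<in> inv_seqs n" "occ Q (respell f g j e) j"
    "\<And>i. i \<in> S \<Longrightarrow> i < j \<Longrightarrow> occ L (respell f g j e) i"
    "\<And>i. i \<in> S \<Longrightarrow> j < i \<Longrightarrow> occ R (respell f g j e) i"
proof -
  let ?b = "f (e!j) (e!(j+1)) (e!(j+2)) (e!(j+3))" and ?c = "g (e!j) (e!(j+1)) (e!(j+2)) (e!(j+3))"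
  let ?e = "respell f g j e"
  have len: "j + 3 < length e" and Pj: "P (e!j) (e!(j+1)) (e!(j+2)) (e!(j+3))"
    using j(2) by (auto simp: occ_def)
  have nth: "?e ! i = (if i = j+1 then ?b else if i = j+2 then ?c else e ! i)" if "i < length e" for i
    using that by (auto simp: respell_def nth_list_update)
  have le: "length ?e = length e" by (simp add: respell_def)
  have inv: "e ! i \<le> i" if "i < length e" for i using e that by (auto simp: inv_seqs_def)
  have "?b \<le> j+1 \<and> ?c \<le> j+2" by (rule bound[OF Pj]) (use inv len in auto)
  then show "?e \<in> inv_seqs n" using e nth le by (auto simp: inv_seqs_def)
  show "occ Q ?e j" using PQ[OF Pj] len by (simp add: occ_def le nth)
  show "occ L ?e i" if i: "i \<in> S" "i < j" for i
  proof -
    have o: "i + 3 < length e" "L (e!i) (e!(i+1)) (e!(i+2)) (e!(i+3))"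
      using left_occ[OF i] by (auto simp: occ_def)
    have "j \<noteq> Suc i" using gap i j by blast
    then consider "j = i+2" | "j \<ge> i+3" using i by linarith
    then show ?thesis
    proof cases
      case 1
      have "L (e!i) (e!(i+1)) (e!j) ?b"
        using left[of i "e!i" "e!(i+1)" "e!j", OF i(1) _ _ Pj] j(1) o 1 by (simp add: numeral_eq_Suc)
      moreover have "?e ! i = e ! i" "?e ! (i+1) = e ! (i+1)" "?e ! (i+2) = e ! j" "?e ! (i+3) = ?b"
        using nth[of i] nth[of "i+1"] nth[of "i+2"] nth[of "i+3"] o 1 by simp_all
      ultimately show ?thesis using o by (simp only: occ_def le)
    next
      case 2 then show ?thesis using o by (simp add: occ_def le nth)
    qed
  qed
  show "occ R ?e i" if i: "i \<in> S" "j < i" for i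
  proof -
    have o: "i + 3 < length e" "R (e!i) (e!(i+1)) (e!(i+2)) (e!(i+3))"
      using right_occ[OF i] by (auto simp: occ_def)
    have "i \<noteq> Suc j" using gap i j by blast
    then consider "i = j+2" | "i \<ge> j+3" using i by linarith
    then show ?thesis
    proof cases
      case 1
      have "R ?c (e!(i+1)) (e!(i+2)) (e!(i+3))"
        using right[of j, OF j(1) _ Pj] i o 1 by (simp add: numeral_eq_Suc)
      then show ?thesis using 1 o by (simp add: occ_def le nth)
    next
      case 2 then show ?thesis using o by (simp add: occ_def le nth)
    qed
  qed
qed

lemma respell_inverse:
  assumes "occ P e j"
    and "\<And>a b c d. P a b c d \<Longrightarrow> f' a (f a b c d) (g a b c d) d = b \<and> g' a (f a b c d) (g a b c d) d = c"
  shows "respell f' g' j (respell f g j e) = e"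
proof (rule nth_equalityI)
  fix i assume "i < length (respell f' g' j (respell f g j e))"
  then show "respell f' g' j (respell f g j e) ! i = e ! i"
    using assms by (auto simp: respell_def occ_def nth_list_update)
qed (simp add: respell_def)

text \<open>\<open>pick p v a b c d\<close> is the entry playing the role of letter \<open>v\<close> in the occurrence \<open>a b c d\<close> of \<open>p\<close>.\<close>

definition pick :: "nat list \<Rightarrow> nat \<Rightarrow> nat \<Rightarrow> nat \<Rightarrow> nat \<Rightarrow> nat \<Rightarrow> nat" where
  "pick p v a b c d = (if p!0 = v then a else if p!1 = v then b else if p!2 = v then c else d)"

text \<open>The variable \<open>k\<close> stands for the 0-based position of the occurrence, so the
  last clause says that the inversion bounds survive.\<close>

definition respells :: "nat list \<Rightarrow> nat list \<Rightarrow> bool" where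
  "respells p q \<longleftrightarrow> (\<forall>a b c d. matches p a b c d \<longrightarrow>
     (let b' = pick p (q!1) a b c d; c' = pick p (q!2) a b c d in
       matches q a b' c' d \<and> pick q (p!1) a b' c' d = b \<and> pick q (p!2) a b' c' d = c \<and>
       (\<forall>k. a \<le> k \<and> b \<le> k+1 \<and> c \<le> k+2 \<and> d \<le> k+3 \<longrightarrow> b' \<le> k+1 \<and> c' \<le> k+2)))"

definition overlaps2 :: "nat list \<Rightarrow> bool" where
  "overlaps2 p \<longleftrightarrow> (\<exists>a b c d s t. matches p a b c d \<and> matches p c d s t)"

text \<open>Rewriting at position \<open>j\<close> between \<open>p\<close> and \<open>q\<close>, in both directions, preserves \<open>q\<close> at
  position \<open>j - 2\<close> and \<open>p\<close> at position \<open>j + 2\<close>. The condition is not symmetric in \<open>p\<close> and \<open>q\<close>.\<close>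

definition compatible2 :: "nat list \<Rightarrow> nat list \<Rightarrow> bool" where
  "compatible2 p q \<longleftrightarrow>
     (\<forall>u v a b c d. matches q u v a b \<and> matches p a b c d \<longrightarrow> matches q u v a (pick p (q!1) a b c d)) \<and>
     (\<forall>u v a b c d. matches q u v a b \<and> matches q a b c d \<longrightarrow> matches q u v a (pick q (p!1) a b c d)) \<and>
     (\<forall>a b c d s t. matches p a b c d \<and> matches p c d s t \<longrightarrow> matches p (pick p (q!2) a b c d) d s t) \<and>
     (\<forall>a b c d s t. matches q a b c d \<and> matches p c d s t \<longrightarrow> matches p (pick q (p!2) a b c d) d s t)"

definition exchangeable :: "nat list \<Rightarrow> nat list \<Rightarrow> bool" where
  "exchangeable p q \<longleftrightarrow> respells p q \<and> respells q p \<and>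
     (\<forall>a b c d s. \<not> (matches p a b c d \<and> matches p b c d s) \<and> \<not> (matches q a b c d \<and> matches q b c d s)) \<and>
     (\<not> overlaps2 p \<and> \<not> overlaps2 q \<or> compatible2 p q)"

text \<open>Hybrid sets, with \<open>q\<close> required left of a cut and \<open>p\<close> from the
  cut on, interpolate between the two sides; moving the cut past an element of \<open>S\<close> is a
  bijection.\<close>

lemma exchange_card:
  assumes "exchangeable p q" "finite S"
  shows "card {e \<in> inv_seqs n. \<forall>i\<in>S. occ (matches p) e i} = card {e \<in> inv_seqs n. \<forall>i\<in>S. occ (matches q) e i}"
\<comment> \<open>If \<open>S\<close> contains two positions whose occurrences cannot coexist, both
  sides are empty.\<close>
proof (cases "\<exists>i\<in>S. Suc i \<in> S \<or> i + 2 \<in> S \<and> \<not> compatible2 p q")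
  case True
  then obtain i where i: "i \<in> S" "Suc i \<in> S \<or> i + 2 \<in> S \<and> \<not> compatible2 p q" by blast
  have 1: "\<not> (occ (matches r) e i \<and> occ (matches r) e (Suc i))" if "r = p \<or> r = q" for r e
  proof -
    have "\<not> (matches r a b c d \<and> matches r b c d s)" for a b c d s
      using assms(1) that unfolding exchangeable_def by metis
    from this[of "e!i" "e!(i+1)" "e!(i+2)" "e!(i+3)" "e!(i+4)"]
    show ?thesis by (auto simp: occ_def numeral_eq_Suc)
  qed
  have 2: "\<not> (occ (matches r) e i \<and> occ (matches r) e (i+2))" if "r = p \<or> r = q" "\<not> compatible2 p q" for r e
  proof -
    have "\<not> overlaps2 r" using assms(1) that unfolding exchangeable_def by metis
    then have "\<not> (matches r a b c d \<and> matches r c d s t)" for a b c d s t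
      unfolding overlaps2_def by metis
    from this[of "e!i" "e!(i+1)" "e!(i+2)" "e!(i+3)" "e!(i+4)" "e!(i+5)"]
    show ?thesis by (auto simp: occ_def numeral_eq_Suc)
  qed
  have "{e \<in> inv_seqs n. \<forall>i\<in>S. occ (matches r) e i} = {}" if "r = p \<or> r = q" for r
    using 1[OF that] 2[OF that] i by blast
  then show ?thesis by metis
next
  case False
  then have gap: "Suc i \<notin> S" if "i \<in> S" for i using that by blast
  have compat: "compatible2 p q" if "i \<in> S" "i + 2 \<in> S" for i using that False by blast
  \<comment> \<open>The hybrid with cut at \<open>j\<close>.\<close>
  define X where "X j = {e \<in> inv_seqs n. \<forall>i\<in>S. occ (matches (if i < j then q else p)) e i}" for j
  define up where "up = respell (pick p (q!1)) (pick p (q!2))"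
  define down where "down = respell (pick q (p!1)) (pick q (p!2))"
  have rpq: "respells p q" "respells q p" using assms(1) unfolding exchangeable_def by blast+
  have mem_X: "e \<in> X j \<longleftrightarrow> e \<in> inv_seqs n \<and> (\<forall>i\<in>S. i < j \<longrightarrow> occ (matches q) e i)
      \<and> (\<forall>i\<in>S. j \<le> i \<longrightarrow> occ (matches p) e i)" for e j
  proof -
    have "occ (matches (if i < j then q else p)) e i \<longleftrightarrow>
        (i < j \<longrightarrow> occ (matches q) e i) \<and> (j \<le> i \<longrightarrow> occ (matches p) e i)" for i
      by simp
    then show ?thesis unfolding X_def mem_Collect_eq by blast
  qed
  have step: "card (X j) = card (X (Suc j))" if jS: "j \<in> S" for j
  proof -
    have Xj: "e \<in> X j \<longleftrightarrow> e \<in> inv_seqs n \<and> occ (matches p) e j \<and>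
        (\<forall>i\<in>S. i < j \<longrightarrow> occ (matches q) e i) \<and> (\<forall>i\<in>S. j < i \<longrightarrow> occ (matches p) e i)" for e
      using jS unfolding mem_X le_less by blast
    have XSj: "e \<in> X (Suc j) \<longleftrightarrow> e \<in> inv_seqs n \<and> occ (matches q) e j \<and>
        (\<forall>i\<in>S. i < j \<longrightarrow> occ (matches q) e i) \<and> (\<forall>i\<in>S. j < i \<longrightarrow> occ (matches p) e i)" for e
      using jS unfolding mem_X less_Suc_eq Suc_le_eq by blast
    have upX: "up j e \<in> X (Suc j) \<and> down j (up j e) = e" if "e \<in> X j" for e
    proof
      have e: "e \<in> inv_seqs n" "occ (matches p) e j"
        "\<And>i. i \<in> S \<Longrightarrow> i < j \<Longrightarrow> occ (matches q) e i" "\<And>i. i \<in> S \<Longrightarrow> j < i \<Longrightarrow> occ (matches p) e i"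
        using that Xj by blast+
      \<comment> \<open>Here \<open>L\<close> is a match of \<open>q\<close> and \<open>R\<close> a
        match of \<open>p\<close>, which are the overlaps that \<open>compatible2\<close>
        controls.\<close>
      have "up j e \<in> inv_seqs n" "occ (matches q) (up j e) j"
        "\<And>i. i \<in> S \<Longrightarrow> i < j \<Longrightarrow> occ (matches q) (up j e) i"
        "\<And>i. i \<in> S \<Longrightarrow> j < i \<Longrightarrow> occ (matches p) (up j e) i"
        unfolding up_def
        by (rule respell_occ[OF e(1) jS e(2,3,4) gap, where Q = "matches q"];
            use rpq compat in \<open>simp add: respells_def Let_def compatible2_def\<close>)+
      then show "up j e \<in> X (Suc j)" unfolding XSj by blast
      show "down j (up j e) = e"
        unfolding up_def down_def
        by (rule respell_inverse[OF e(2)]) (use rpq in \<open>simp add: respells_def Let_def\<close>)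
    qed
    have downX: "down j e \<in> X j \<and> up j (down j e) = e" if "e \<in> X (Suc j)" for e
    proof
      have e: "e \<in> inv_seqs n" "occ (matches q) e j"
        "\<And>i. i \<in> S \<Longrightarrow> i < j \<Longrightarrow> occ (matches q) e i" "\<And>i. i \<in> S \<Longrightarrow> j < i \<Longrightarrow> occ (matches p) e i"
        using that XSj by blast+
      have "down j e \<in> inv_seqs n" "occ (matches p) (down j e) j"
        "\<And>i. i \<in> S \<Longrightarrow> i < j \<Longrightarrow> occ (matches q) (down j e) i"
        "\<And>i. i \<in> S \<Longrightarrow> j < i \<Longrightarrow> occ (matches p) (down j e) i"
        unfolding down_def
        by (rule respell_occ[OF e(1) jS e(2,3,4) gap, where Q = "matches p"];
            use rpq compat in \<open>simp add: respells_def Let_def compatible2_def\<close>)+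
      then show "down j e \<in> X j" unfolding Xj by blast
      show "up j (down j e) = e"
        unfolding up_def down_def
        by (rule respell_inverse[OF e(2)]) (use rpq in \<open>simp add: respells_def Let_def\<close>)
    qed
    have "bij_betw (up j) (X j) (X (Suc j))"
      by (rule bij_betw_byWitness[where f' = "down j"]) (use upX downX in auto)
    then show ?thesis by (rule bij_betw_same_card)
  qed
  have "card (X j) = card (X 0)" for j
  proof (induction j)
    case (Suc j)
    show ?case
    proof (cases "j \<in> S")
      case True then show ?thesis using step Suc by simp
    next
      case False
      then have "(i < Suc j) = (i < j)" if "i \<in> S" for i using that by (auto simp: less_Suc_eq)
      then have "X (Suc j) = X j" by (simp add: X_def)
      then show ?thesis using Suc by simp
    qed
  qed simp
  \<comment> \<open>A cut beyond the finite set \<open>S\<close> requires only \<open>q\<close>; the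
    cut at 0 requires only \<open>p\<close>.\<close>
  moreover obtain m where "\<And>i. i \<in> S \<Longrightarrow> i < m" using finite_nat_set_iff_bounded assms(2) by auto
  then have "X m = {e \<in> inv_seqs n. \<forall>i\<in>S. occ (matches q) e i}" by (simp add: X_def)
  moreover have "X 0 = {e \<in> inv_seqs n. \<forall>i\<in>S. occ (matches p) e i}" by (simp add: X_def)
  ultimately show ?thesis by metis
qed

lemma exchangeable_super_strong:
  assumes p: "is_pattern 4 p" and q: "is_pattern 4 q" and ex: "exchangeable p q"
  shows "super_strongly_wilf_equiv p q"
  unfolding super_strongly_wilf_equiv_def
proof (intro allI impI)
  fix n T assume T: "T \<subseteq> {1..n::nat}"
  have sub: "Em r e \<subseteq> {1..n}" if "is_pattern 4 r" "e \<in> inv_seqs n" for r e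
    using that by (auto simp: Em_eq occ_def inv_seqs_def)
  have "card {e \<in> inv_seqs n. S \<subseteq> Em p e} = card {e \<in> inv_seqs n. S \<subseteq> Em q e}" if "S \<subseteq> {1..n}" for S
  proof -
    \<comment> \<open>Since \<open>S\<close> has no 0, truncated subtraction does no harm in the
      shift to 0-based positions.\<close>
    have S: "S = Suc ` ((\<lambda>i. i - 1) ` S)" using that by (force simp: image_image)
    have iff: "S \<subseteq> Em r e \<longleftrightarrow> (\<forall>i\<in>(\<lambda>i. i - 1) ` S. occ (matches r) e i)" if "is_pattern 4 r" for r e
      by (subst S) (auto simp: Em_eq[OF that] inj_image_subset_iff simp del: image_image)
    have "finite ((\<lambda>i. i - 1) ` S)" using that finite_subset by blast
    from exchange_card[OF ex this, of n]
    show ?thesis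
      by (simp only: iff[OF p] iff[OF q])
  qed
  then show "card {e \<in> inv_seqs n. Em p e = T} = card {e \<in> inv_seqs n. Em q e = T}"
    by (intro card_fibres_eq_if_supersets_eq[where U = "{1..n}"] finite_inv_seqs T sub p q) auto
qed

section \<open>Exchangeable pairs within the groups\<close>

lemmas exchange_defs = exchangeable_def respells_def overlaps2_def compatible2_def
  matches_def same_order_def pick_def Let_def

text \<open>The pairs form a chain through each group. Their orientation matters: in the first pair,
  \<open>compatible2\<close> fails with \<open>[0,1,0,2]\<close> in front, since the overlapping
  occurrences \<open>0 1 0 2 0 3\<close> would be rewritten at the left into
  \<open>0 1 1 2 0 3\<close>, destroying the right one.\<close>

lemma exchangeable_pairs:
  "exchangeable [0,1,1,2] [0,1,0,2]"
  "exchangeable [0,0,2,1] [0,1,2,1]"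
  "exchangeable [1,0,0,2] [1,0,1,2]"
  "exchangeable [1,0,1,2] [1,1,0,2]"
  "exchangeable [0,1,0,0] [0,1,1,0]"
  "exchangeable [2,0,1,3] [2,1,0,3]"
  "exchangeable [1,2,0,0] [1,2,1,0]"
  "exchangeable [1,2,1,0] [1,2,2,0]"
  "exchangeable [0,2,1,1] [0,2,2,1]"
  "exchangeable [1,0,0,0] [1,1,1,0]"
  "exchangeable [1,0,0,1] [1,0,1,1]"
  "exchangeable [1,0,1,1] [1,1,0,1]"
  "exchangeable [2,1,0,0] [2,2,1,0]"
  "exchangeable [2,0,0,1] [2,0,1,1]"
  "exchangeable [2,0,1,1] [2,1,0,1]"
  "exchangeable [2,1,0,1] [2,2,0,1]"
  "exchangeable [2,0,1,2] [2,1,0,2]"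
  "exchangeable [2,0,1,0] [2,1,1,0]"
  "exchangeable [2,1,1,0] [2,1,2,0]"
  "exchangeable [3,0,1,2] [3,1,0,2]"
  by (auto simp: exchange_defs)

text \<open>Turns the equivalence into an equality of functions, so symmetry and transitivity along
  the chains come from rewriting. The value 0 outside \<open>{1..n}\<close> discards the sets over
  which the equivalence does not quantify.\<close>

definition Em_profile :: "nat list \<Rightarrow> nat \<Rightarrow> nat set \<Rightarrow> nat" where
  "Em_profile p n T = (if T \<subseteq> {1..n} then card {e \<in> inv_seqs n. Em p e = T} else 0)"

lemma super_strong_iff_Em_profile: "super_strongly_wilf_equiv p q \<longleftrightarrow> Em_profile p = Em_profile q"
  unfolding super_strongly_wilf_equiv_def fun_eq_iff Em_profile_def by presburger

lemma Em_profile_eq: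
  assumes "exchangeable p q" "is_pattern 4 p" "is_pattern 4 q"
  shows "Em_profile p = Em_profile q"
  using exchangeable_super_strong assms super_strong_iff_Em_profile by blast

lemma groups4_super_strong:
  assumes "G \<in> set groups4" "p \<in> set G" "q \<in> set G"
  shows "super_strongly_wilf_equiv p q"
proof -
  note eqs = exchangeable_pairs[THEN Em_profile_eq, unfolded is_pattern_def, simplified]
  show ?thesis
    using assms unfolding super_strong_iff_Em_profile groups4_def by (auto simp: eqs)
qed

subsection \<open>Counting avoiders\<close>

definition ending :: "nat list \<Rightarrow> nat \<Rightarrow> nat \<Rightarrow> nat \<Rightarrow> nat \<Rightarrow> nat list set" where
  "ending p k x y z = {e \<in> avoiders p (k+3). e ! k = x \<and> e ! (k+1) = y \<and> e ! (k+2) = z}"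

lemma avoiders_iff:
  assumes "is_pattern 4 p"
  shows "e \<in> avoiders p n \<longleftrightarrow> e \<in> inv_seqs n \<and> (\<forall>i. \<not> occ (matches p) e i)"
  by (auto simp: avoiders_def Em_eq[OF assms])

lemma inv_seqs_snoc: "e @ [w] \<in> inv_seqs (Suc n) \<longleftrightarrow> e \<in> inv_seqs n \<and> w \<le> n"
proof (cases "length e = n")
  case True
  then have "(\<forall>k<Suc n. (e @ [w]) ! k < Suc k) \<longleftrightarrow> (\<forall>k<n. e ! k < Suc k) \<and> w < Suc n"
    unfolding All_less_Suc by (simp add: nth_append) blast
  then show ?thesis using True by (simp add: inv_seqs_def less_Suc_eq_le)
qed (simp add: inv_seqs_def)

lemma occ_snoc:
  assumes "length e = k + 3"
  shows "occ P (e @ [w]) i \<longleftrightarrow> occ P e i \<or> i = k \<and> P (e!k) (e!(k+1)) (e!(k+2)) w"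
proof -
  consider "i < k" | "i = k" | "i > k" by linarith
  then show ?thesis using assms by cases (auto simp: occ_def nth_append)
qed

lemma snoc_in_avoiders:
  assumes "is_pattern 4 p" "length e = k + 3"
  shows "e @ [w] \<in> avoiders p (k+4) \<longleftrightarrow>
    e \<in> avoiders p (k+3) \<and> w \<le> k+3 \<and> \<not> matches p (e!k) (e!(k+1)) (e!(k+2)) w"
  using inv_seqs_snoc[of e w "k+3"]
  by (auto simp: avoiders_iff[OF assms(1)] occ_snoc[OF assms(2)] add.commute)

lemma length_avoider: "e \<in> avoiders p n \<Longrightarrow> length e = n"
  by (simp add: avoiders_def inv_seqs_def)

lemma finite_avoiders: "finite (avoiders p n)"
  unfolding avoiders_def using finite_inv_seqs by simp

lemma ending_subset: "ending p k x y z \<subseteq> avoiders p (k+3)"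
  by (auto simp: ending_def)

lemma finite_ending: "finite (ending p k x y z)"
  by (rule finite_subset[OF ending_subset finite_avoiders])

text \<open>Deleting the final \<open>w\<close> leaves an avoider ending in some
  \<open>x y z\<close>, and \<open>x y z w\<close> is the only window lost. Conversely
  \<open>w\<close> may be appended unless that window matches.\<close>

lemma card_ending_step:
  assumes p: "is_pattern 4 p" and w: "w \<le> k+3"
  shows "card (ending p (Suc k) y z w) = (\<Sum>x\<in>{..<Suc k}. if matches p x y z w then 0 else card (ending p k x y z))"
proof -
  have "ending p (Suc k) y z w = (\<lambda>e. e @ [w]) ` (\<Union>x\<in>{x. x < Suc k \<and> \<not> matches p x y z w}. ending p k x y z)"
  proof (intro set_eqI iffI)
    fix e assume e: "e \<in> ending p (Suc k) y z w"
    then have l: "length e = k+4" by (auto simp: ending_def dest: length_avoider)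
    then obtain e' v where ev: "e = e' @ [v]" by (cases e rule: rev_cases) auto
    have l': "length e' = k+3" using l ev by simp
    have v: "v = w" "e' ! (k+1) = y" "e' ! (k+2) = z" using e l' unfolding ending_def ev by (auto simp: nth_append)
    have "e' \<in> avoiders p (k+3)" "\<not> matches p (e'!k) y z w"
      using e snoc_in_avoiders[OF p l', of w] v by (auto simp: ending_def ev numeral_eq_Suc)
    \<comment> \<open>The inversion bound at position \<open>k\<close> gives the summation range for
      \<open>x\<close>.\<close>
    moreover have "e' ! k < Suc k" using calculation(1) by (auto simp: avoiders_def inv_seqs_def)
    ultimately show "e \<in> (\<lambda>e. e @ [w]) ` (\<Union>x\<in>{x. x < Suc k \<and> \<not> matches p x y z w}. ending p k x y z)"
      using v ev by (auto simp: ending_def)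
  next
    fix e assume "e \<in> (\<lambda>e. e @ [w]) ` (\<Union>x\<in>{x. x < Suc k \<and> \<not> matches p x y z w}. ending p k x y z)"
    then obtain e' where e': "e = e' @ [w]" "e' \<in> ending p k (e'!k) y z" "\<not> matches p (e'!k) y z w"
      by (auto simp: ending_def)
    then have l': "length e' = k+3" by (auto simp: ending_def dest: length_avoider)
    show "e \<in> ending p (Suc k) y z w"
      using e' snoc_in_avoiders[OF p l', of w] w l' by (auto simp: ending_def nth_append numeral_eq_Suc)
  qed
  then have "card (ending p (Suc k) y z w) = card (\<Union>x\<in>{x. x < Suc k \<and> \<not> matches p x y z w}. ending p k x y z)"
    by (simp add: card_image inj_on_def)
  also have "\<dots> = (\<Sum>x\<in>{x. x < Suc k \<and> \<not> matches p x y z w}. card (ending p k x y z))"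
    by (rule card_UN_disjoint) (simp_all add: finite_ending, auto simp: ending_def)
  also have "\<dots> = (\<Sum>x\<in>{..<Suc k}. if matches p x y z w then 0 else card (ending p k x y z))"
    by (rule sum.mono_neutral_cong_left) auto
  finally show ?thesis .
qed

lemma card_avoiders_eq_sum:
  "card (avoiders p (k+3)) = (\<Sum>z<k+3. \<Sum>y<k+2. \<Sum>x<k+1. card (ending p k x y z))"
proof -
  have bound: "e ! k < k+1" "e ! (k+1) < k+2" "e ! (k+2) < k+3" if "e \<in> avoiders p (k+3)" for e
    using that by (auto simp: avoiders_def inv_seqs_def numeral_eq_Suc)
  have ends: "x = e ! k \<and> y = e ! (k+1) \<and> z = e ! (k+2)" if "e \<in> ending p k x y z" for e x y z
    using that by (simp add: ending_def)
  have "avoiders p (k+3) = (\<Union>z<k+3. \<Union>y<k+2. \<Union>x<k+1. ending p k x y z)"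
    using bound by (fastforce simp: ending_def)
  also have "card \<dots> = (\<Sum>z<k+3. card (\<Union>y<k+2. \<Union>x<k+1. ending p k x y z))"
    by (rule card_UN_disjoint) (simp_all add: finite_ending, use ends in blast)
  also have "\<dots> = (\<Sum>z<k+3. \<Sum>y<k+2. card (\<Union>x<k+1. ending p k x y z))"
    by (rule sum.cong[OF refl], rule card_UN_disjoint)
      (simp_all add: finite_ending, use ends in blast)
  also have "\<dots> = (\<Sum>z<k+3. \<Sum>y<k+2. \<Sum>x<k+1. card (ending p k x y z))"
    by (rule sum.cong[OF refl], rule sum.cong[OF refl], rule card_UN_disjoint)
      (simp_all add: finite_ending, use ends in blast)
  finally show ?thesis .
qed

text \<open>In a table, the entry \<open>(z, (y, (x, c)))\<close> says that \<open>c\<close> avoiders end in \<open>x y z\<close>. The test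
  for a match is split into a part \<open>B\<close> not involving the oldest entry \<open>x\<close> and the rest \<open>C\<close>, since
  wherever \<open>B\<close> fails a plain row sum suffices.\<close>

type_synonym table = "(nat \<times> (nat \<times> (nat \<times> int) list) list) list"

section \<open>Dynamic programming on tables\<close>

definition endings :: "nat list \<Rightarrow> nat \<Rightarrow> table" where
  "endings p k = map (\<lambda>z. (z, map (\<lambda>y. (y, map (\<lambda>x. (x, int (card (ending p k x y z)))) [0..<k+1])) [0..<k+2])) [0..<k+3]"

definition total :: "table \<Rightarrow> int" where
  "total R = sum_list (map (\<lambda>(z, rs). sum_list (map (\<lambda>(y, xs). sum_list (map snd xs)) rs)) R)"

text \<open>Summing out \<open>x\<close> leaves \<open>y\<close> as the oldest of the new last three
  entries; \<open>n\<close> is the number of admissible values of \<open>w\<close>.\<close>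

definition next_table :: "(nat \<Rightarrow> nat \<Rightarrow> nat \<Rightarrow> bool) \<Rightarrow> (nat \<Rightarrow> nat \<Rightarrow> nat \<Rightarrow> nat \<Rightarrow> bool) \<Rightarrow> nat \<Rightarrow> table \<Rightarrow> table" where
  "next_table B C n R = map (\<lambda>w. (w, map (\<lambda>(z, rs). (z, map (\<lambda>(y, xs). (y,
     if B y z w then sum_list (map (\<lambda>(x, c). if C x y z w then 0 else c) xs)
     else sum_list (map snd xs))) rs)) R)) [0..<n]"

primrec totals :: "(nat \<Rightarrow> nat \<Rightarrow> nat \<Rightarrow> bool) \<Rightarrow> (nat \<Rightarrow> nat \<Rightarrow> nat \<Rightarrow> nat \<Rightarrow> bool) \<Rightarrow> nat \<Rightarrow> nat \<Rightarrow> table \<Rightarrow> int list" where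
  "totals B C k 0 R = [total R]"
| "totals B C k (Suc m) R = total R # totals B C (Suc k) m (next_table B C (k+4) R)"

text \<open>The literal table lists the six inversion sequences of length 3, all starting with 0 and
  too short to contain a pattern of length 4.\<close>

definition avoider_counts :: "nat list \<Rightarrow> nat \<Rightarrow> int list" where
  "avoider_counts p m = totals
     (\<lambda>b c d. same_order (p!2) (p!3) c d \<and> same_order (p!1) (p!2) b c \<and> same_order (p!1) (p!3) b d)
     (\<lambda>a b c d. same_order (p!0) (p!1) a b \<and> same_order (p!0) (p!2) a c \<and> same_order (p!0) (p!3) a d)
     0 m [(0, [(0, [(0, 1)]), (1, [(0, 1)])]), (1, [(0, [(0, 1)]), (1, [(0, 1)])]), (2, [(0, [(0, 1)]), (1, [(0, 1)])])]"

lemma total_endings: "total (endings p k) = int (card (avoiders p (k+3)))"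
  unfolding total_def endings_def map_map comp_def prod.case snd_conv card_avoiders_eq_sum
  by (simp only: interv_sum_list_conv_sum_set_nat set_upt atLeast0LessThan of_nat_sum)

lemma next_table_endings:
  assumes "is_pattern 4 p" "\<And>a b c d. matches p a b c d \<longleftrightarrow> B b c d \<and> C a b c d"
  shows "next_table B C (k+4) (endings p k) = endings p (Suc k)"
proof -
  have "int (card (ending p (Suc k) y z w)) =
     (if B y z w then \<Sum>x\<leftarrow>[0..<k+1]. if C x y z w then 0 else int (card (ending p k x y z))
      else \<Sum>x\<leftarrow>[0..<k+1]. int (card (ending p k x y z)))" if "w < k+4" for y z w
  proof -
    have "int (card (ending p (Suc k) y z w)) = (\<Sum>x\<in>{..<k+1}. int (if matches p x y z w then 0 else card (ending p k x y z)))"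
      using card_ending_step[OF assms(1), of w k y z] that by simp
    also have "\<dots> = (\<Sum>x\<in>{..<k+1}. if B y z w \<and> C x y z w then 0 else int (card (ending p k x y z)))"
      by (rule sum.cong) (simp_all add: assms(2))
    finally show ?thesis
      by (cases "B y z w") (simp_all only: interv_sum_list_conv_sum_set_nat atLeast0LessThan set_upt simp_thms if_True if_False)
  qed
  then have "next_table B C (k+4) (endings p k) =
      map (\<lambda>z. (z, map (\<lambda>y. (y, map (\<lambda>x. (x, int (card (ending p (Suc k) x y z)))) [0..<k+2])) [0..<k+3])) [0..<k+4]"
    unfolding next_table_def endings_def map_map comp_def prod.case snd_conv by (auto simp del: upt_Suc)
  also have "\<dots> = endings p (Suc k)"
  proof -
    have "Suc k + 1 = k + 2" "Suc k + 2 = k + 3" "Suc k + 3 = k + 4" by simp_all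
    then show ?thesis unfolding endings_def by (simp only:)
  qed
  finally show ?thesis .
qed

lemma totals_endings:
  assumes "is_pattern 4 p" "\<And>a b c d. matches p a b c d \<longleftrightarrow> B b c d \<and> C a b c d"
  shows "totals B C k m (endings p k) = map (\<lambda>i. int (card (avoiders p (k+3+i)))) [0..<Suc m]"
proof (induction m arbitrary: k)
  case 0 show ?case by (simp add: total_endings)
next
  case (Suc m)
  have "[0..<Suc (Suc m)] = 0 # map Suc [0..<Suc m]"
    by (simp add: upt_conv_Cons map_Suc_upt del: upt_Suc)
  then show ?case
    by (simp add: next_table_endings[OF assms] Suc.IH total_endings comp_def ac_simps del: upt_Suc)
qed

text \<open>No window of length 4 fits into length 3, and the first entry is forced to be 0, so
  \<open>y\<close> and \<open>z\<close> determine the sequence.\<close>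

lemma card_ending_0:
  assumes "is_pattern 4 p" "y < 2" "z < 3"
  shows "card (ending p 0 0 y z) = 1"
proof -
  have "e \<in> avoiders p 3 \<longleftrightarrow> e \<in> inv_seqs 3" for e
    by (auto simp: avoiders_iff[OF assms(1)] occ_def inv_seqs_def)
  then have ending: "e \<in> ending p 0 0 y z \<longleftrightarrow> e \<in> inv_seqs 3 \<and> e ! 0 = 0 \<and> e ! 1 = y \<and> e ! 2 = z" for e
    by (simp only: ending_def mem_Collect_eq add_0)
  have lt3: "k < 3 \<longleftrightarrow> k = 0 \<or> k = 1 \<or> k = 2" for k :: nat by auto
  have "[0, y, z] \<in> inv_seqs 3" using assms(2,3) by (auto simp: inv_seqs_def lt3)
  moreover have "e = [0, y, z]" if "e \<in> ending p 0 0 y z" for e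
  proof (rule nth_equalityI)
    show "length e = length [0, y, z]" using that unfolding ending by (simp add: inv_seqs_def)
    fix i assume "i < length e"
    then have "i = 0 \<or> i = 1 \<or> i = 2" using that unfolding ending by (simp add: inv_seqs_def lt3)
    then show "e ! i = [0, y, z] ! i" using that unfolding ending by (elim disjE) simp_all
  qed
  ultimately have "ending p 0 0 y z = {[0, y, z]}" using ending by auto
  then show ?thesis by simp
qed

lemma avoider_counts:
  assumes "is_pattern 4 p"
  shows "avoider_counts p m = map (\<lambda>i. int (card (avoiders p (3+i)))) [0..<Suc m]"
proof -
  have "endings p 0 = [(0, [(0, [(0, 1)]), (1, [(0, 1)])]), (1, [(0, [(0, 1)]), (1, [(0, 1)])]), (2, [(0, [(0, 1)]), (1, [(0, 1)])])]"
    by (simp add: endings_def card_ending_0[OF assms] numeral_eq_Suc)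
  moreover have "totals
     (\<lambda>b c d. same_order (p!2) (p!3) c d \<and> same_order (p!1) (p!2) b c \<and> same_order (p!1) (p!3) b d)
     (\<lambda>a b c d. same_order (p!0) (p!1) a b \<and> same_order (p!0) (p!2) a c \<and> same_order (p!0) (p!3) a d)
     0 m (endings p 0) = map (\<lambda>i. int (card (avoiders p (0+3+i)))) [0..<Suc m]"
    by (rule totals_endings[OF assms]) (simp only: matches_def)
  ultimately show ?thesis
    unfolding avoider_counts_def by (simp only: add_0)
qed

text \<open>For every pattern of length 4, the numbers of avoiders of length 3, 4, \<open>\<dots>\<close> up to the first
  length at which they differ from those of all patterns outside its group.\<close>

definition counts_table :: "(nat list \<times> int list) list" where
  "counts_table = [
    ([0,0,0,0], [6, 23, 114]),
    ([0,0,0,1], [6, 21, 98]),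
    ([0,0,1,2], [6, 21, 96]),
    ([0,1,0,2], [6, 22, 103]),
    ([0,1,1,2], [6, 22, 103]),
    ([0,0,1,0], [6, 22, 105, 612]),
    ([0,0,1,1], [6, 22, 105, 617]),
    ([0,1,0,1], [6, 23, 112, 661]),
    ([0,1,2,3], [6, 23, 111, 642]),
    ([1,0,0,2], [6, 24, 117, 682]),
    ([1,0,1,2], [6, 24, 117, 682]),
    ([1,0,2,3], [6, 24, 117, 678]),
    ([1,1,0,2], [6, 24, 117, 682]),
    ([2,0,1,3], [6, 24, 120, 714]),
    ([2,1,0,3], [6, 24, 120, 714]),
    ([0,0,2,1], [6, 23, 111, 646, 4408]),
    ([0,1,0,0], [6, 23, 112, 660, 4564]),
    ([0,1,1,0], [6, 23, 112, 660, 4564]),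
    ([0,1,1,1], [6, 23, 112, 660, 4563]),
    ([0,1,2,0], [6, 23, 111, 646, 4412]),
    ([0,1,2,1], [6, 23, 111, 646, 4408]),
    ([0,1,2,2], [6, 23, 111, 646, 4405]),
    ([0,2,1,3], [6, 24, 118, 690, 4687]),
    ([1,0,1,0], [6, 24, 119, 708, 4921]),
    ([1,0,3,2], [6, 24, 119, 704, 4839]),
    ([1,2,0,3], [6, 24, 118, 690, 4680]),
    ([0,1,3,2], [6, 24, 119, 704, 4838, 37868]),
    ([0,2,1,0], [6, 24, 119, 706, 4882, 38586]),
    ([0,2,1,2], [6, 24, 119, 706, 4882, 38581]),
    ([0,2,3,1], [6, 24, 119, 704, 4838, 37874]),
    ([1,0,0,0], [6, 24, 119, 708, 4920, 39120]),
    ([1,0,0,1], [6, 24, 119, 708, 4920, 39121]),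
    ([1,0,1,1], [6, 24, 119, 708, 4920, 39121]),
    ([1,0,2,0], [6, 24, 118, 694, 4767, 37454]),
    ([1,0,2,1], [6, 24, 118, 694, 4767, 37464]),
    ([1,0,2,2], [6, 24, 118, 694, 4762, 37393]),
    ([1,1,0,0], [6, 24, 119, 708, 4920, 39122]),
    ([1,1,0,1], [6, 24, 119, 708, 4920, 39121]),
    ([1,1,1,0], [6, 24, 119, 708, 4920, 39120]),
    ([1,1,2,0], [6, 24, 118, 694, 4762, 37376]),
    ([1,2,0,0], [6, 24, 119, 706, 4882, 38576]),
    ([1,2,1,0], [6, 24, 119, 706, 4882, 38576]),
    ([1,2,2,0], [6, 24, 119, 706, 4882, 38576]),
    ([1,2,3,0], [6, 24, 119, 704, 4838, 37864]),
    ([2,0,3,1], [6, 24, 120, 716, 4958, 39078]),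
    ([2,1,3,0], [6, 24, 120, 716, 4958, 39064]),
    ([0,2,0,1], [6, 24, 119, 706, 4882, 38584, 343185]),
    ([0,2,1,1], [6, 24, 119, 706, 4882, 38582, 343137]),
    ([0,2,2,1], [6, 24, 119, 706, 4882, 38582, 343137]),
    ([0,3,1,2], [6, 24, 120, 718, 4996, 39608, 352280]),
    ([0,3,2,1], [6, 24, 120, 718, 4996, 39608, 352292]),
    ([1,2,0,1], [6, 24, 119, 706, 4882, 38582, 343155]),
    ([1,2,0,2], [6, 24, 119, 706, 4882, 38584, 343191]),
    ([1,3,0,2], [6, 24, 120, 718, 4996, 39608, 352302]),
    ([2,0,1,2], [6, 24, 120, 718, 5002, 39776, 355586]),
    ([2,1,0,2], [6, 24, 120, 718, 5002, 39776, 355586]),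
    ([3,2,1,0], [6, 24, 120, 720, 5034, 40152, 359592]),
    ([1,3,2,0], [6, 24, 120, 718, 4996, 39608, 352272, 3472550]),
    ([2,0,0,1], [6, 24, 120, 718, 5002, 39776, 355584, 3530722]),
    ([2,0,1,0], [6, 24, 120, 718, 5002, 39776, 355590, 3530890]),
    ([2,0,1,1], [6, 24, 120, 718, 5002, 39776, 355584, 3530722]),
    ([2,0,2,1], [6, 24, 120, 718, 5002, 39776, 355590, 3530902]),
    ([2,1,0,0], [6, 24, 120, 718, 5002, 39776, 355584, 3530710]),
    ([2,1,0,1], [6, 24, 120, 718, 5002, 39776, 355584, 3530722]),
    ([2,1,1,0], [6, 24, 120, 718, 5002, 39776, 355590, 3530890]),
    ([2,1,2,0], [6, 24, 120, 718, 5002, 39776, 355590, 3530890]),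
    ([2,2,0,1], [6, 24, 120, 718, 5002, 39776, 355584, 3530722]),
    ([2,2,1,0], [6, 24, 120, 718, 5002, 39776, 355584, 3530710]),
    ([2,3,0,1], [6, 24, 120, 718, 4996, 39608, 352272, 3472544]),
    ([2,3,1,0], [6, 24, 120, 718, 4996, 39608, 352272, 3472460]),
    ([3,1,2,0], [6, 24, 120, 720, 5034, 40152, 359568, 3570504]),
    ([3,0,1,2], [6, 24, 120, 720, 5034, 40152, 359568, 3570480, 38922972]),
    ([3,0,2,1], [6, 24, 120, 720, 5034, 40152, 359568, 3570480, 38923020]),
    ([3,1,0,2], [6, 24, 120, 720, 5034, 40152, 359568, 3570480, 38922972]),
    ([3,2,0,1], [6, 24, 120, 720, 5034, 40152, 359568, 3570480, 38922900])]"

section \<open>Numerical separation of the classes\<close>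

text \<open>A run of \<open>m\<close> steps yields \<open>m + 1\<close> totals, starting at length
  3; hence the subtraction of 1.\<close>

lemma avoider_counts_table:
  "list_all (\<lambda>(p, cs). avoider_counts p (length cs - 1) = cs) counts_table"
  by code_simp

text \<open>Enumeration of all 256 words over four letters; the 75 patterns among them correspond to
  the weak orders on four positions.\<close>

lemma patterns4:
  assumes p: "is_pattern 4 p"
  shows "p \<in> set (map fst counts_table)"
proof -
  have "length p = Suc (Suc (Suc (Suc 0)))" using p by (simp add: is_pattern_def)
  then obtain a b c d where abcd: "p = [a,b,c,d]" unfolding length_Suc_conv by auto
  have lt4: "k < 4 \<longleftrightarrow> k = 0 \<or> k = 1 \<or> k = 2 \<or> k = 3" for k :: nat by auto
  have "a < 4" "b < 4" "c < 4" "d < 4" using p by (simp_all add: is_pattern_def abcd)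
  then show ?thesis
    using p unfolding abcd lt4 by (elim disjE) (simp_all add: is_pattern_def counts_table_def)
qed

text \<open>Rows stop at different lengths, so they are compared on their common length only: one
  must be a prefix of the other.\<close>

fun agree :: "'a list \<Rightarrow> 'a list \<Rightarrow> bool" where
  "agree (x # xs) (y # ys) \<longleftrightarrow> x = y \<and> agree xs ys"
| "agree _ _ \<longleftrightarrow> True"

lemma agree_map: "agree (map f [k..<m]) (map f [k..<n])"
proof (induction "m - k" arbitrary: k)
  case (Suc d)
  then show ?case by (cases "k < n") (simp_all add: upt_conv_Cons)
qed simp

text \<open>Read contrapositively: distinct patterns sharing no group already differ within the
  shorter of their rows.\<close>

lemma agreeing_counts_table:
  "list_all (\<lambda>(p, cs). list_all (\<lambda>(q, ds). 
     if agree cs ds then p = q \<or> list_ex (\<lambda>G. List.member G p \<and> List.member G q) groups4 else True) counts_table) counts_table"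
  by code_simp

theorem theorem1:
  shows "(\<forall>G\<in>set groups4. \<forall>p\<in>set G. \<forall>q\<in>set G. super_strongly_wilf_equiv p q)
    \<and> (\<forall>p q. is_pattern 4 p \<and> is_pattern 4 q \<and> p \<noteq> q \<and> wilf_equiv p q
          \<longrightarrow> (\<exists>G\<in>set groups4. p \<in> set G \<and> q \<in> set G))"
proof (intro conjI allI impI)
  show "\<forall>G\<in>set groups4. \<forall>p\<in>set G. \<forall>q\<in>set G. super_strongly_wilf_equiv p q"
    using groups4_super_strong by blast
next
  fix p q assume *: "is_pattern 4 p \<and> is_pattern 4 q \<and> p \<noteq> q \<and> wilf_equiv p q"
  then obtain cs ds where table: "(p, cs) \<in> set counts_table" "(q, ds) \<in> set counts_table"
    using patterns4 by (metis (no_types, lifting) imageE list.set_map prod.collapse)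
  let ?f = "\<lambda>i. int (card (avoiders p (3+i)))"
  have f: "?f = (\<lambda>i. int (card (avoiders q (3+i))))"
    using * by (simp add: wilf_equiv_def)
  have "cs = avoider_counts p (length cs - 1)" "ds = avoider_counts q (length ds - 1)"
    using avoider_counts_table table unfolding list_all_iff by fastforce+
  \<comment> \<open>By Wilf equivalence both rows are initial segments of one and the same
    sequence.\<close>
  then have "cs = map ?f [0..<Suc (length cs - 1)]" "ds = map ?f [0..<Suc (length ds - 1)]"
    using * avoider_counts f by metis+
  then have "agree cs ds" using agree_map by metis
  moreover have "if agree cs ds then p = q \<or> list_ex (\<lambda>G. List.member G p \<and> List.member G q) groups4 else True"
    using agreeing_counts_table table unfolding list_all_iff by fast
  ultimately show "\<exists>G\<in>set groups4. p \<in> set G \<and> q \<in> set G"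
    using * by (auto simp: list_ex_iff)
qed

end
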